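(* Let $\Omega\subset\mathbb{R}^d$, $d\in\{2,3\}$, be a sufficiently smooth bounded domain, let $\varphi^{n-1},\varphi^n\in H^1(\Omega)$ and let $\lambda^n\in\mathcal{N}_+$. Then for every constant $c>0$ the variational inequality $$(\lambda^n-\xi,\ \varphi^n-\varphi^{n-1})\ \geq\ 0\qquad\text{for all }\xi\in\mathcal{N}_+$$ is equivalent to the complementarity condition $$C(\varphi^n,\lambda^n):=\lambda^n-\max\{0,\ \lambda^n+c(\varphi^n-\varphi^{n-1})\}=0\qquad\text{a.e. in }\Omega .$$
   Context: $(x,y)=\int_\Omega x\,y\,\mathrm{d}\Omega$ denotes the $L^2(\Omega)$ inner product. The sets used are $$L^2_-(\Omega):=\{v\in L^2(\Omega)\ |\ v\le 0\ \text{a.e. in }\Omega\},$$ $$\mathcal{N}_+:=\{\mu\in L^2(\Omega)\ |\ (\mu,v)\le 0\ \text{ for all } v\in L^2_-(\Omega)\}.$$ The max operation is defined by $$\max\{0,\ \lambda^n+c(\varphi^n-\varphi^{n-1})\}=\begin{cases}0&\text{in }\mathcal{I},\\ \lambda^n+c(\varphi^n-\varphi^{n-1})&\text{in }\mathcal{A},\end{cases}$$ where the inactive set $\mathcal{I}\subset\Omega$ and the active set $\mathcal{A}\subset\Omega$ are such that $\lambda^n+c(\varphi^n-\varphi^{n-1})\le 0$ a.e. in $\mathcal{I}$ and $\lambda^n+c(\varphi^n-\varphi^{n-1})>0$ a.e. in $\mathcal{A}$, and $\Omega\setminus(\mathcal{I}\cup\mathcal{A})$ is a null set. That is, it is the usual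 pointwise a.e. maximum of functions in $L^2(\Omega)$. Here $\varphi^n$ and $\varphi^{n-1}$ are the phase-field functions at two consecutive incremental steps, and $\lambda^n$ is the Lagrange multiplier for the constraint $\varphi^n\le\varphi^{n-1}$. *)

theory Defs
  imports "HOL-Analysis.Analysis"
begin

section \<open>Functions and domains of class \<open>C\<^sup>k\<close>\<close>

text \<open>In finite dimension, continuity of all directional derivatives of a
  differentiable function is continuity of its derivative, and inductively for higher orders.\<close>

primrec Ck :: "nat \<Rightarrow> ('a::euclidean_space \<Rightarrow> real) \<Rightarrow> bool" where
  "Ck 0 f \<longleftrightarrow> continuous_on UNIV f"
| "Ck (Suc k) f \<longleftrightarrow>
     (\<forall>x. f differentiable (at x)) \<and>
     (\<forall>v. Ck k (\<lambda>x. frechet_derivative f (at x) v))"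

text \<open>Near every boundary point, the set lies strictly above the graph of a \<open>C\<^sup>k\<close> function over
  the hyperplane orthogonal to a unit vector \<open>e\<close>. The function \<open>\<gamma>\<close> is taken on the whole space
  but only evaluated on that hyperplane.\<close>

definition Ck_boundary :: "nat \<Rightarrow> 'a::euclidean_space set \<Rightarrow> bool" where
  "Ck_boundary k \<Omega> \<longleftrightarrow>
     (\<forall>p\<in>frontier \<Omega>. \<exists>r>0. \<exists>e \<gamma>. norm e = 1 \<and> Ck k \<gamma> \<and>
        \<Omega> \<inter> ball p r = {x \<in> ball p r. \<gamma> (x - (x \<bullet> e) *\<^sub>R e) < x \<bullet> e})"

definition bounded_Ck_domain :: "nat \<Rightarrow> 'a::euclidean_space set \<Rightarrow> bool" where
  "bounded_Ck_domain k \<Omega> \<longleftrightarrow>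
     open \<Omega> \<and> connected \<Omega> \<and> \<Omega> \<noteq> {} \<and> bounded \<Omega> \<and> Ck_boundary k \<Omega>"

section \<open>Function spaces\<close>

text \<open>Elements of \<open>L\<^sup>2(\<Omega>)\<close> are represented by functions on the whole space; only their values on
  \<open>\<Omega>\<close>, up to Lebesgue null sets, matter. Equality in \<open>L\<^sup>2(\<Omega>)\<close> is equality almost everywhere
  in \<open>\<Omega>\<close>.\<close>

definition L2 :: "'a::euclidean_space set \<Rightarrow> ('a \<Rightarrow> real) set" where
  "L2 \<Omega> = {v \<in> borel_measurable (lebesgue_on \<Omega>). integrable (lebesgue_on \<Omega>) (\<lambda>x. (v x)\<^sup>2)}"

definition L2_inner :: "'a::euclidean_space set \<Rightarrow> ('a \<Rightarrow> real) \<Rightarrow> ('a \<Rightarrow> real) \<Rightarrow> real" where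
  "L2_inner \<Omega> u v = (LINT x|lebesgue_on \<Omega>. u x * v x)"

definition test_function :: "'a::euclidean_space set \<Rightarrow> ('a \<Rightarrow> real) \<Rightarrow> bool" where
  "test_function \<Omega> \<psi> \<longleftrightarrow>
     (\<forall>k. Ck k \<psi>) \<and> compact (closure {x. \<psi> x \<noteq> 0}) \<and> closure {x. \<psi> x \<noteq> 0} \<subseteq> \<Omega>"

definition weak_partial ::
  "'a::euclidean_space set \<Rightarrow> 'a \<Rightarrow> ('a \<Rightarrow> real) \<Rightarrow> ('a \<Rightarrow> real) \<Rightarrow> bool" where
  "weak_partial \<Omega> i u g \<longleftrightarrow>
     (\<forall>\<psi>. test_function \<Omega> \<psi> \<longrightarrow>
        L2_inner \<Omega> u (\<lambda>x. frechet_derivative \<psi> (at x) i) = - L2_inner \<Omega> g \<psi>)"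

definition H1 :: "'a::euclidean_space set \<Rightarrow> ('a \<Rightarrow> real) set" where
  "H1 \<Omega> = {u \<in> L2 \<Omega>. \<forall>i\<in>Basis. \<exists>g\<in>L2 \<Omega>. weak_partial \<Omega> i u g}"

definition L2_minus :: "'a::euclidean_space set \<Rightarrow> ('a \<Rightarrow> real) set" where
  "L2_minus \<Omega> = {v \<in> L2 \<Omega>. AE x in lebesgue_on \<Omega>. v x \<le> 0}"

definition N_plus :: "'a::euclidean_space set \<Rightarrow> ('a \<Rightarrow> real) set" where
  "N_plus \<Omega> = {\<mu> \<in> L2 \<Omega>. \<forall>v\<in>L2_minus \<Omega>. L2_inner \<Omega> \<mu> v \<le> 0}"

section \<open>The complementarity function\<close>

definition compl_fun ::
  "real \<Rightarrow> ('a \<Rightarrow> real) \<Rightarrow> ('a \<Rightarrow> real) \<Rightarrow> ('a \<Rightarrow> real) \<Rightarrow> 'a \<Rightarrow> real" where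
  "compl_fun c \<phi>_old \<phi> lam x = lam x - max 0 (lam x + c * (\<phi> x - \<phi>_old x))"

end

theory Submission
  imports Defs
begin

text \<open>
  Testing with \<open>min 0 \<mu>\<close> shows that \<open>N_plus\<close> consists of the a.e. nonnegative functions of \<open>L2\<close>.
  Put \<open>w = \<phi> - \<phi>_old\<close> and let \<open>r = lam - max 0 (lam + c * w)\<close> be the residual. The function
  \<open>max 0 (lam + c * w)\<close> is admissible in the variational inequality, and \<open>r\<^sup>2 \<le> - c * r * w\<close>
  holds wherever \<open>lam \<ge> 0\<close>; integrating gives \<open>r = 0\<close> a.e. Conversely, \<open>r = 0\<close> forces
  \<open>w \<le> 0\<close> and \<open>lam * w = 0\<close>, so that \<open>(lam - \<xi>) * w = - \<xi> * w \<ge> 0\<close> for every \<open>\<xi> \<ge> 0\<close>.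
\<close>

text \<open>Reduces the closure properties of \<open>L2\<close> under sums and positive parts to a
  pointwise bound on squares.\<close>

lemma L2_dominated:
  assumes u: "u \<in> borel_measurable (lebesgue_on \<Omega>)"
    and g: "integrable (lebesgue_on \<Omega>) g" and le: "\<And>x. (u x)\<^sup>2 \<le> g x"
  shows "u \<in> L2 \<Omega>"
proof -
  have "integrable (lebesgue_on \<Omega>) (\<lambda>x. (u x)\<^sup>2)"
    by (rule Bochner_Integration.integrable_bound[OF g])
       (use u le in \<open>auto intro!: AE_I2 order_trans[OF le]\<close>)
  then show ?thesis using u by (simp add: L2_def)
qed

lemma L2_cmult: "u \<in> L2 \<Omega> \<Longrightarrow> (\<lambda>x. c * u x) \<in> L2 \<Omega>"
  by (auto simp: L2_def power_mult_distrib)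

lemma L2_add:
  assumes "u \<in> L2 \<Omega>" "v \<in> L2 \<Omega>"
  shows "(\<lambda>x. u x + v x) \<in> L2 \<Omega>"
proof (rule L2_dominated)
  show "integrable (lebesgue_on \<Omega>) (\<lambda>x. 2 * (u x)\<^sup>2 + 2 * (v x)\<^sup>2)"
    using assms by (auto simp: L2_def)
  \<comment> \<open>The right side exceeds the left by exactly
    \<open>(u x - v x)\<^sup>2\<close>.\<close>
  show "(u x + v x)\<^sup>2 \<le> 2 * (u x)\<^sup>2 + 2 * (v x)\<^sup>2" for x
    using zero_le_power2[of "u x - v x"] by (simp add: power2_eq_square algebra_simps)
qed (use assms in \<open>auto simp: L2_def\<close>)

lemma L2_diff: "u \<in> L2 \<Omega> \<Longrightarrow> v \<in> L2 \<Omega> \<Longrightarrow> (\<lambda>x. u x - v x) \<in> L2 \<Omega>"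
  using L2_add[of u \<Omega> "\<lambda>x. -1 * v x"] L2_cmult[of v \<Omega> "-1"] by simp

lemma L2_max_0:
  assumes "u \<in> L2 \<Omega>"
  shows "(\<lambda>x. max 0 (u x)) \<in> L2 \<Omega>"
proof (rule L2_dominated)
  show "integrable (lebesgue_on \<Omega>) (\<lambda>x. (u x)\<^sup>2)"
    using assms by (simp add: L2_def)
qed (use assms in \<open>auto simp: L2_def max_def\<close>)

lemma integrable_L2_mult:
  assumes "u \<in> L2 \<Omega>" "v \<in> L2 \<Omega>"
  shows "integrable (lebesgue_on \<Omega>) (\<lambda>x. u x * v x)"
proof (rule Bochner_Integration.integrable_bound)
  show "integrable (lebesgue_on \<Omega>) (\<lambda>x. (u x)\<^sup>2 + (v x)\<^sup>2)"
    using assms by (auto simp: L2_def)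
  have "\<bar>u x * v x\<bar> \<le> (u x)\<^sup>2 + (v x)\<^sup>2" for x
    using sum_squares_bound[of "\<bar>u x\<bar>" "\<bar>v x\<bar>"]
      mult_nonneg_nonneg[of "\<bar>u x\<bar>" "\<bar>v x\<bar>"]
    unfolding abs_mult power2_abs by linarith
  then show "AE x in lebesgue_on \<Omega>. norm (u x * v x) \<le> norm ((u x)\<^sup>2 + (v x)\<^sup>2)"
    by simp
qed (use assms in \<open>auto simp: L2_def\<close>)

lemma L2_eq_0_AE:
  assumes "u \<in> L2 \<Omega>" "(LINT x|lebesgue_on \<Omega>. (u x)\<^sup>2) \<le> 0"
  shows "AE x in lebesgue_on \<Omega>. u x = 0"
proof -
  have "(LINT x|lebesgue_on \<Omega>. (u x)\<^sup>2) = 0"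
    using assms(2) by (intro antisym) auto
  then have "AE x in lebesgue_on \<Omega>. (u x)\<^sup>2 = 0"
    using assms(1) by (subst (asm) integral_nonneg_eq_0_iff_AE) (auto simp: L2_def)
  then show ?thesis by simp
qed

lemma N_plus_iff:
  "\<mu> \<in> N_plus \<Omega> \<longleftrightarrow> \<mu> \<in> L2 \<Omega> \<and> (AE x in lebesgue_on \<Omega>. 0 \<le> \<mu> x)"
proof (intro iffI conjI)
  assume \<mu>: "\<mu> \<in> N_plus \<Omega>"
  then show L2: "\<mu> \<in> L2 \<Omega>" by (simp add: N_plus_def)
  define v where "v x = min 0 (\<mu> x)" for x
  \<comment> \<open>Writing \<open>v\<close> through the positive part of \<open>\<mu>\<close> makes
    the closure lemmas for \<open>L2\<close> applicable.\<close>
  have "v = (\<lambda>x. \<mu> x - max 0 (\<mu> x))"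
    by (auto simp: v_def fun_eq_iff min_def max_def)
  then have vL2: "v \<in> L2 \<Omega>"
    using L2_diff[OF L2 L2_max_0[OF L2]] by simp
  then have "v \<in> L2_minus \<Omega>"
    by (simp add: L2_minus_def v_def)
  \<comment> \<open>Either \<open>v x\<close> vanishes or it equals \<open>\<mu> x\<close>, so
    pairing with \<open>\<mu>\<close> returns the squared norm of \<open>v\<close>.\<close>
  moreover have "\<mu> x * v x = (v x)\<^sup>2" for x
    by (auto simp: v_def min_def power2_eq_square)
  ultimately have "(LINT x|lebesgue_on \<Omega>. (v x)\<^sup>2) \<le> 0"
    using \<mu> by (auto simp: N_plus_def L2_inner_def)
  then have "AE x in lebesgue_on \<Omega>. v x = 0"
    by (rule L2_eq_0_AE[OF vL2])
  then show "AE x in lebesgue_on \<Omega>. 0 \<le> \<mu> x"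
    by eventually_elim (auto simp: v_def min_def split: if_splits)
next
  assume *: "\<mu> \<in> L2 \<Omega> \<and> (AE x in lebesgue_on \<Omega>. 0 \<le> \<mu> x)"
  have "L2_inner \<Omega> \<mu> v \<le> 0" if "v \<in> L2_minus \<Omega>" for v
  proof -
    have "AE x in lebesgue_on \<Omega>. v x \<le> 0"
      using that by (simp add: L2_minus_def)
    with conjunct2[OF *] have "AE x in lebesgue_on \<Omega>. 0 \<le> - (\<mu> x * v x)"
      by eventually_elim (simp add: mult_nonneg_nonpos)
    then have "0 \<le> (LINT x|lebesgue_on \<Omega>. - (\<mu> x * v x))"
      by (rule integral_nonneg_AE)
    then show ?thesis by (simp add: L2_inner_def)
  qed
  with * show "\<mu> \<in> N_plus \<Omega>" by (simp add: N_plus_def)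
qed

text \<open>If \<open>l + c * w > 0\<close>, the residual is \<open>- c * w\<close> and equality
  holds. Otherwise it is \<open>l\<close>, and multiplying \<open>l \<le> - c * w\<close> by
  \<open>l \<ge> 0\<close> gives the bound.\<close>

lemma residual_square_le:
  fixes c l w :: real
  assumes "0 \<le> l"
  shows "(l - max 0 (l + c * w))\<^sup>2 \<le> - c * ((l - max 0 (l + c * w)) * w)"
proof (cases "l + c * w > 0")
  case False
  then have "l * l \<le> l * - (c * w)"
    using assms by (intro mult_left_mono) auto
  then show ?thesis
    using False by (simp add: max_def power2_eq_square algebra_simps)
qed (simp add: max_def power2_eq_square algebra_simps)

text \<open>Where the maximum is 0, also \<open>l = 0\<close>, hence \<open>c * w \<le> 0\<close>.
  Where it is \<open>l + c * w\<close>, cancelling \<open>l\<close> leaves \<open>c * w = 0\<close>.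
  In both cases dividing by \<open>c > 0\<close> settles \<open>w\<close>.\<close>

lemma residual_zero_imp:
  fixes c l w :: real
  assumes "l - max 0 (l + c * w) = 0" "c > 0"
  shows "w \<le> 0" "l * w = 0"
  using assms by (auto simp: max_def mult_le_0_iff zero_le_mult_iff split: if_splits)

theorem lemma2p4:
  fixes \<Omega> :: "(real ^ 'd) set"
    and \<phi>_old \<phi> lam :: "real ^ 'd \<Rightarrow> real"
    and k :: nat
    and c :: real
  assumes "CARD('d) \<in> {2, 3}"
    and "bounded_Ck_domain k \<Omega>"
    and "\<phi>_old \<in> H1 \<Omega>" and "\<phi> \<in> H1 \<Omega>"
    and "lam \<in> N_plus \<Omega>"
    and "c > 0"
  shows "(\<forall>\<xi>\<in>N_plus \<Omega>. L2_inner \<Omega> (\<lambda>x. lam x - \<xi> x) (\<lambda>x. \<phi> x - \<phi>_old x) \<ge> 0)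
     \<longleftrightarrow> (AE x in lebesgue_on \<Omega>. compl_fun c \<phi>_old \<phi> lam x = 0)"
proof -
  define w where "w x = \<phi> x - \<phi>_old x" for x
  have w: "w \<in> L2 \<Omega>"
    using assms(3,4) L2_diff[of \<phi> \<Omega> \<phi>_old] by (simp add: H1_def w_def[abs_def])
  have lam: "lam \<in> L2 \<Omega>" and lam_nonneg: "AE x in lebesgue_on \<Omega>. 0 \<le> lam x"
    using assms(5) by (auto simp: N_plus_iff)
  \<comment> \<open>This is the pointwise projection of \<open>lam + c * w\<close> onto the
    nonnegative functions, hence an element of \<open>N_plus \<Omega>\<close>.\<close>
  define \<eta> where "\<eta> x = max 0 (lam x + c * w x)" for x
  have \<eta>: "\<eta> \<in> L2 \<Omega>"
    unfolding \<eta>_def[abs_def] by (intro L2_max_0 L2_add L2_cmult lam w)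
  then have \<eta>_N: "\<eta> \<in> N_plus \<Omega>"
    by (simp add: N_plus_iff \<eta>_def)
  define r where "r x = lam x - \<eta> x" for x
  have r: "r \<in> L2 \<Omega>"
    using L2_diff[OF lam \<eta>] by (simp add: r_def[abs_def])
  have compl_eq: "compl_fun c \<phi>_old \<phi> lam = r"
    by (simp add: fun_eq_iff compl_fun_def r_def \<eta>_def w_def)
  have "(\<forall>\<xi>\<in>N_plus \<Omega>. L2_inner \<Omega> (\<lambda>x. lam x - \<xi> x) w \<ge> 0)
      \<longleftrightarrow> (AE x in lebesgue_on \<Omega>. r x = 0)"
  proof (intro iffI ballI)
    assume "\<forall>\<xi>\<in>N_plus \<Omega>. L2_inner \<Omega> (\<lambda>x. lam x - \<xi> x) w \<ge> 0"
    from bspec[OF this \<eta>_N] have vi: "0 \<le> (LINT x|lebesgue_on \<Omega>. r x * w x)"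
      by (simp add: L2_inner_def r_def)
    have "AE x in lebesgue_on \<Omega>. (r x)\<^sup>2 \<le> - c * (r x * w x)"
      using lam_nonneg by eventually_elim (simp only: r_def \<eta>_def residual_square_le)
    moreover have "integrable (lebesgue_on \<Omega>) (\<lambda>x. (r x)\<^sup>2)"
      using r by (simp add: L2_def)
    moreover have "integrable (lebesgue_on \<Omega>) (\<lambda>x. - c * (r x * w x))"
      by (intro integrable_mult_right integrable_L2_mult r w)
    ultimately have "(LINT x|lebesgue_on \<Omega>. (r x)\<^sup>2)
        \<le> (LINT x|lebesgue_on \<Omega>. - c * (r x * w x))"
      by (intro integral_mono_AE)
    \<comment> \<open>Here \<open>c > 0\<close> turns the lower bound \<open>vi\<close> into an
      upper bound on the squared norm of \<open>r\<close>.\<close>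
    also have "\<dots> \<le> 0"
      using vi \<open>c > 0\<close> by simp
    finally show "AE x in lebesgue_on \<Omega>. r x = 0"
      by (rule L2_eq_0_AE[OF r])
  next
    fix \<xi> assume r0: "AE x in lebesgue_on \<Omega>. r x = 0" and "\<xi> \<in> N_plus \<Omega>"
    then have "AE x in lebesgue_on \<Omega>. 0 \<le> \<xi> x"
      by (simp add: N_plus_iff)
    with r0 have "AE x in lebesgue_on \<Omega>. 0 \<le> (lam x - \<xi> x) * w x"
    proof eventually_elim
      case (elim x)
      then have "w x \<le> 0" "lam x * w x = 0"
        using residual_zero_imp[OF _ \<open>c > 0\<close>] by (simp_all only: r_def \<eta>_def)
      then show ?case
        using mult_nonneg_nonpos[OF elim(2), of "w x"] by (auto simp: left_diff_distrib)
    qed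
    then show "0 \<le> L2_inner \<Omega> (\<lambda>x. lam x - \<xi> x) w"
      unfolding L2_inner_def by (rule integral_nonneg_AE)
  qed
  then show ?thesis
    by (simp add: compl_eq w_def[abs_def])
qed

end
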